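(* There exists a sequence of integral trees $(T_n)_{n\ge1}$ such that each $T_n$ contains a pair of cospectral vertices at distance $2$, and the minimum distance between two distinct elements of $\Phi(T_n)$ tends to $\infty$ as $n\to\infty$.
   Context: A graph is integral if all eigenvalues of its adjacency matrix are integers. $\Phi(T)$ denotes the set of distinct eigenvalues of the adjacency matrix of $T$. Two vertices $i,j$ of a graph $G$ are cospectral if $\phi^{G\setminus i}=\phi^{G\setminus j}$, where $\phi^H$ denotes the characteristic polynomial of the adjacency matrix of $H$ and $G\setminus v$ is the graph with vertex $v$ deleted. *)

theory Defs
  imports
    "Graph_Theory.Digraph_Component"
    "Graph_Theory.Shortest_Path"
    "Jordan_Normal_Form.Spectral_Radius"
begin

text \<open>
  A finite simple undirected graph is a symmetric digraph satisfying the locale predicate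
  \<^const>\<open>graph\<close>: finite, without loops and without parallel arcs. Every undirected edge
  is a pair of opposite arcs, and these form a \<^const>\<open>pre_digraph.cycle\<close> of length 2. So
  \<^const>\<open>forest\<close> fails for every such graph that has an edge; an undirected cycle is a
  \<^const>\<open>pre_digraph.cycle\<close> of length at least 3.
\<close>

definition undirected_tree :: "('a, 'b) pre_digraph \<Rightarrow> bool" where
  "undirected_tree G \<longleftrightarrow>
     graph G \<and> Digraph_Component.connected G \<and>
     \<not> (\<exists>p. pre_digraph.cycle G p \<and> 3 \<le> length p)"

definition graph_dist :: "('a, 'b) pre_digraph \<Rightarrow> 'a \<Rightarrow> 'a \<Rightarrow> ereal" where
  "graph_dist G u v = wf_digraph.\<mu> G (\<lambda>_. 1) u v"

text \<open>
  Rows and columns follow the increasing enumeration of the vertex set; another enumeration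
  would conjugate the matrix by a permutation matrix. The entries are complex, so that the
  spectrum consists of all eigenvalues with no appeal to the spectral theorem.
\<close>

definition adjacency_matrix :: "('a :: linorder, 'b) pre_digraph \<Rightarrow> complex mat" where
  "adjacency_matrix G =
     (let vs = sorted_list_of_set (verts G); n = card (verts G)
      in mat n n (\<lambda>(i, j). if vs ! i \<rightarrow>\<^bsub>G\<^esub> vs ! j then 1 else 0))"

definition graph_char_poly :: "('a :: linorder, 'b) pre_digraph \<Rightarrow> complex poly" where
  "graph_char_poly G = char_poly (adjacency_matrix G)"

definition graph_spectrum :: "('a :: linorder, 'b) pre_digraph \<Rightarrow> complex set" where
  "graph_spectrum G = spectrum (adjacency_matrix G)"

definition integral_graph :: "('a :: linorder, 'b) pre_digraph \<Rightarrow> bool" where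
  "integral_graph G \<longleftrightarrow> graph_spectrum G \<subseteq> \<int>"

definition cospectral_vertices :: "('a :: linorder, 'b) pre_digraph \<Rightarrow> 'a \<Rightarrow> 'a \<Rightarrow> bool" where
  "cospectral_vertices G i j \<longleftrightarrow>
     i \<in> verts G \<and> j \<in> verts G \<and>
     graph_char_poly (pre_digraph.del_vert G i) = graph_char_poly (pre_digraph.del_vert G j)"

text \<open>
  Unspecified if the spectrum has a single element; a tree with at least two vertices has at
  least two distinct eigenvalues, since its nonzero symmetric adjacency matrix has trace 0.
\<close>

definition min_eigenvalue_gap :: "('a :: linorder, 'b) pre_digraph \<Rightarrow> real" where
  "min_eigenvalue_gap G =
     Min {dist x y | x y. x \<in> graph_spectrum G \<and> y \<in> graph_spectrum G \<and> x \<noteq> y}"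

end

theory Submission
  imports Defs
begin

text \<open>
  The star with \<open>m\<^sup>2\<close> leaves has spectrum \<open>{-m, 0, m}\<close> for \<open>m \<ge> 2\<close>. Any two of its leaves are at distance 2,
  and deleting either of them leaves a star of the same size, so they are cospectral.
\<close>

text \<open>The center is 0. The vertex set is a parameter so that deleting a leaf yields an
  instance of the same definition; pairs serve as arcs so that each edge appears in both
  directions.\<close>

definition star :: "nat set \<Rightarrow> (nat, nat \<times> nat) pre_digraph" where
  "star V = \<lparr>verts = V, arcs = {(u, v). u \<in> V \<and> v \<in> V \<and> (u = 0) \<noteq> (v = 0)},
     tail = fst, head = snd\<rparr>"

lemma star_simps [simp]:
  "verts (star V) = V"
  "arcs (star V) = {(u, v). u \<in> V \<and> v \<in> V \<and> (u = 0) \<noteq> (v = 0)}"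
  "tail (star V) = fst"
  "head (star V) = snd"
  by (simp_all add: star_def)

lemma star_adj: "u \<rightarrow>\<^bsub>star V\<^esub> v \<longleftrightarrow> u \<in> V \<and> v \<in> V \<and> (u = 0) \<noteq> (v = 0)"
  by (force simp: arcs_ends_conv)

lemma del_vert_star: "pre_digraph.del_vert (star V) v = star (V - {v})"
  by (auto simp: pre_digraph.del_vert_def star_def)

lemma graph_star:
  assumes "finite V"
  shows "graph (star V)"
proof -
  have "finite (arcs (star V))"
    by (rule finite_subset[of _ "V \<times> V"]) (use assms in auto)
  moreover have "symmetric (star V)"
    by (auto simp: symmetric_conv)
  ultimately show ?thesis
    using assms by unfold_locales (auto simp: arc_to_ends_def)
qed

lemma connected_star:
  assumes "finite V" "0 \<in> V"
  shows "Digraph_Component.connected (star V)"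
proof -
  interpret graph "star V"
    using assms(1) by (rule graph_star)
  have to_center: "u \<rightarrow>\<^sup>*\<^bsub>star V\<^esub> 0" if "u \<in> V" for u
    using that assms(2) by (cases "u = 0") (auto simp: star_adj intro: reachable_adjI)
  have "u \<rightarrow>\<^sup>*\<^bsub>star V\<^esub> v" if "u \<in> V" "v \<in> V" for u v
    using to_center[OF that(1)] symmetric_reachable'[OF to_center[OF that(2)]]
    by (rule reachable_trans)
  \<comment> \<open>\<open>connected\<close> refers to the symmetric closure, to which reachability
    in the star carries over.\<close>
  then show ?thesis
    unfolding connected_def using assms(2)
    by (intro strongly_connectedI) (auto intro!: reachable_mk_symmetricI)
qed

text \<open>A closed walk with at least three arcs visits the center twice after its first vertex.\<close>

lemma star_cycle_length:
  assumes "finite V" "pre_digraph.cycle (star V) p"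
  shows "length p < 3"
proof (rule ccontr)
  interpret graph "star V"
    using assms(1) by (rule graph_star)
  assume "\<not> length p < 3"
  then obtain e1 e2 e3 q where p: "p = e1 # e2 # e3 # q"
    by (metis One_nat_def Suc_1 length_Cons list.size(3) list.exhaust lessI
        less_Suc_eq numeral_3_eq_3 zero_less_Suc)
  from assms(2) obtain u where u: "awalk u p u" "distinct (tl (awalk_verts u p))"
    unfolding cycle_def by blast
  from u(1) have e: "fst e1 = u" "fst e2 = snd e1" "fst e3 = snd e2" "cas (snd e3) q u"
    "(fst e1 = 0) \<noteq> (snd e1 = 0)" "(fst e2 = 0) \<noteq> (snd e2 = 0)" "(fst e3 = 0) \<noteq> (snd e3 = 0)"
    unfolding p awalk_def by auto
  from u(2) have d: "fst e2 \<notin> set (awalk_verts (snd e3) q)" "fst e3 \<notin> set (awalk_verts (snd e3) q)"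
    unfolding p by auto
  have "u \<in> set (awalk_verts (snd e3) q)"
    using awlast_if_cas[OF e(4)] last_in_set[of "awalk_verts (snd e3) q"] by (cases q) auto
  moreover have "snd e3 \<in> set (awalk_verts (snd e3) q)"
    using e(4) by (cases q) auto
  \<comment> \<open>If \<open>u\<close> is the center, so is \<open>fst e3\<close>, while
    \<open>u\<close> recurs as the endpoint; otherwise \<open>fst e2\<close> and
    \<open>snd e3\<close> are both the center. Either way \<open>d\<close> is violated.\<close>
  ultimately show False
    using e d by metis
qed

lemma undirected_tree_star:
  assumes "finite V" "0 \<in> V"
  shows "undirected_tree (star V)"
  unfolding undirected_tree_def
  using graph_star[OF assms(1)] connected_star[OF assms] star_cycle_length[OF assms(1)]
  by (meson not_le)

lemma graph_dist_star_leaves: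
  assumes "finite V" "0 \<in> V" "u \<in> V" "v \<in> V" "u \<noteq> 0" "v \<noteq> 0" "u \<noteq> v"
  shows "graph_dist (star V) u v = 2"
proof -
  interpret graph "star V"
    using assms(1) by (rule graph_star)
  have cost: "awalk_cost (\<lambda>_. 1) p = real (length p)" for p :: "(nat \<times> nat) list"
    by (induction p) auto
  \<comment> \<open>An empty walk needs \<open>u = v\<close>, and a single arc has the center as one
    endpoint, so neither joins two distinct leaves.\<close>
  have long: "2 \<le> length p" if "awalk u p v" for p
  proof -
    from that assms show ?thesis
      by (cases p; cases "tl p") (auto simp: awalk_def)
  qed
  have walk: "awalk u [(u, 0), (0, v)] v"
    using assms by (auto simp: awalk_def)
  have "\<mu> (\<lambda>_. 1) u v = 2"
  proof (rule antisym)
    show "\<mu> (\<lambda>_. 1) u v \<le> 2"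
      using min_cost_le_walk_cost[OF walk, of "\<lambda>_. 1"] by simp
    show "2 \<le> \<mu> (\<lambda>_. 1) u v"
      unfolding \<mu>_def using long by (auto intro!: INF_greatest simp: cost)
  qed
  then show ?thesis by (simp add: graph_dist_def)
qed

definition star_matrix :: "nat \<Rightarrow> complex mat" where
  "star_matrix n = mat n n (\<lambda>(i, j). if (i = 0) \<noteq> (j = 0) then 1 else 0)"

lemma star_matrix_dim [simp]: "dim_row (star_matrix n) = n" "dim_col (star_matrix n) = n"
  by (simp_all add: star_matrix_def)

text \<open>As 0 is the least natural number, the sorted enumeration puts the center first. So the
  matrix depends on \<open>V\<close> only through its size.\<close>

lemma adjacency_matrix_star:
  assumes "finite V" "0 \<in> V"
  shows "adjacency_matrix (star V) = star_matrix (card V)"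
proof -
  let ?vs = "sorted_list_of_set V"
  have nth_in: "?vs ! i \<in> V" if "i < card V" for i
    using that assms(1) by (metis length_sorted_list_of_set nth_mem set_sorted_list_of_set)
  have first: "?vs ! 0 = 0"
  proof -
    obtain k where "k < card V" "?vs ! k = 0"
      using assms by (metis in_set_conv_nth length_sorted_list_of_set set_sorted_list_of_set)
    then show ?thesis
      using sorted_nth_mono[of ?vs 0 k] by simp
  qed
  have "?vs ! i = 0 \<longleftrightarrow> i = 0" if "i < card V" for i
    using that first nth_eq_iff_index_eq[of ?vs i 0] by auto
  then show ?thesis
    unfolding adjacency_matrix_def star_matrix_def Let_def
    by (auto simp: star_adj nth_in intro!: cong_mat)
qed

text \<open>Deleting either leaf keeps the center and leaves equally many vertices, so the two
  adjacency matrices are equal and no characteristic polynomial has to be computed.\<close>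

lemma cospectral_star_leaves:
  assumes "finite V" "0 \<in> V" "u \<in> V" "v \<in> V" "u \<noteq> 0" "v \<noteq> 0"
  shows "cospectral_vertices (star V) u v"
  using assms
  by (simp add: cospectral_vertices_def graph_char_poly_def del_vert_star adjacency_matrix_star)

lemma star_matrix_mult_vec:
  assumes "dim_vec v = Suc N" "i < Suc N"
  shows "(star_matrix (Suc N) *\<^sub>v v) $ i = (if i = 0 then \<Sum>j<N. v $ Suc j else v $ 0)"
proof -
  have "(star_matrix (Suc N) *\<^sub>v v) $ i =
      (\<Sum>j<Suc N. (if (i = 0) \<noteq> (j = 0) then 1 else 0) * v $ j)"
    using assms by (auto simp: star_matrix_def scalar_prod_def lessThan_atLeast0 intro!: sum.cong)
  \<comment> \<open>The term \<open>j = 0\<close> belongs to the center and the shifted sum to the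
    leaves; row 0 keeps only the sum, every other row only the center term.\<close>
  then show ?thesis
    by (subst (asm) sum.lessThan_Suc_shift) auto
qed

lemma eigenvalue_star_matrixI:
  assumes "0 < N" "k ^ 2 = of_nat N"
  shows "eigenvalue (star_matrix (Suc N)) k"
proof -
  \<comment> \<open>With leaf entries 1, the leaf rows force the center entry to be
    \<open>k\<close>, and the center row then reads \<open>of_nat N = k ^ 2\<close>. Positivity of
    \<open>N\<close> makes \<open>k\<close>, hence \<open>v\<close>, nonzero.\<close>
  define v where "v = vec (Suc N) (\<lambda>i. if i = 0 then k else 1)"
  have v: "dim_vec v = Suc N" "v $ 0 = k" "\<And>j. j < N \<Longrightarrow> v $ Suc j = 1"
    by (auto simp: v_def)
  have "star_matrix (Suc N) *\<^sub>v v = k \<cdot>\<^sub>v v"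
  proof (rule eq_vecI)
    fix i assume "i < dim_vec (k \<cdot>\<^sub>v v)"
    then have i: "i < Suc N" by (simp add: v)
    show "(star_matrix (Suc N) *\<^sub>v v) $ i = (k \<cdot>\<^sub>v v) $ i"
      using i assms v by (cases i) (auto simp: star_matrix_mult_vec power2_eq_square simp del: index_mult_mat_vec)
  qed (simp add: v)
  moreover have "v \<noteq> 0\<^sub>v (Suc N)"
  proof
    assume *: "v = 0\<^sub>v (Suc N)"
    then have "k = 0" using v(2) by simp
    then show False
      using assms by simp
  qed
  ultimately show ?thesis
    unfolding eigenvalue_def eigenvector_def
    using v(1) by (intro exI[of _ v]) (auto intro: carrier_vecI)
qed

text \<open>Multiplying the center equation by \<open>k\<close> and substituting the leaf equations
  gives \<open>k ^ 2 * v $ 0 = of_nat N * v $ 0\<close>, which settles the case of a nonzero center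
  entry.\<close>

lemma eigenvalue_star_matrixD:
  assumes "eigenvalue (star_matrix (Suc N)) k"
  shows "k = 0 \<or> k ^ 2 = of_nat N"
proof -
  obtain v where v: "dim_vec v = Suc N" "v \<noteq> 0\<^sub>v (Suc N)"
      "star_matrix (Suc N) *\<^sub>v v = k \<cdot>\<^sub>v v"
    using assms unfolding eigenvalue_def eigenvector_def by (metis carrier_vecD star_matrix_dim(1))
  have row: "(if i = 0 then \<Sum>j<N. v $ Suc j else v $ 0) = k * v $ i" if "i < Suc N" for i
    using star_matrix_mult_vec[OF v(1) that] that v(1,3) by simp
  have center: "(\<Sum>j<N. v $ Suc j) = k * v $ 0"
    using row[of 0] by simp
  have leaf: "v $ 0 = k * v $ Suc j" if "j < N" for j
    using row[of "Suc j"] that by simp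
  have "k ^ 2 * v $ 0 = k * (\<Sum>j<N. v $ Suc j)"
    by (simp add: center power2_eq_square)
  also have "\<dots> = (\<Sum>j<N. v $ 0)"
    unfolding sum_distrib_left by (intro sum.cong) (auto simp: leaf)
  finally have "k ^ 2 * v $ 0 = of_nat N * v $ 0" by simp
  \<comment> \<open>If \<open>v $ 0 = 0\<close>, a nonzero \<open>k\<close> would make every leaf
    entry vanish as well, so \<open>v\<close> would be zero.\<close>
  moreover have "k = 0" if "v $ 0 = 0"
  proof (rule ccontr)
    assume "k \<noteq> 0"
    have "v $ i = 0" if "i < Suc N" for i
      using that \<open>v $ 0 = 0\<close> \<open>k \<noteq> 0\<close> leaf by (cases i) auto
    then have "v = 0\<^sub>v (Suc N)"
      by (intro eq_vecI) (auto simp: v(1))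
    with v(2) show False by contradiction
  qed
  ultimately show ?thesis by auto
qed

text \<open>The first inclusion bounds the gaps, the second guarantees two distinct eigenvalues. The
  latter omits 0 because for \<open>m = 1\<close> the star is a single edge, with spectrum
  \<open>{-1, 1}\<close>.\<close>

lemma graph_spectrum_star:
  assumes "finite V" "0 \<in> V" "card V = Suc (m ^ 2)" "0 < m"
  shows "graph_spectrum (star V) \<subseteq> {- of_nat m, 0, of_nat m}"
    and "{- of_nat m, of_nat m} \<subseteq> graph_spectrum (star V)"
proof -
  have spec: "graph_spectrum (star V) = Collect (eigenvalue (star_matrix (Suc (m ^ 2))))"
    by (simp add: graph_spectrum_def spectrum_def adjacency_matrix_star assms)
  have "k = of_nat m \<or> k = - of_nat m" if "k ^ 2 = of_nat (m ^ 2)" for k :: complex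
    using that by (simp add: power2_eq_iff)
  then show "graph_spectrum (star V) \<subseteq> {- of_nat m, 0, of_nat m}"
    unfolding spec using eigenvalue_star_matrixD by blast
  show "{- of_nat m, of_nat m} \<subseteq> graph_spectrum (star V)"
    unfolding spec using assms(4) by (auto intro: eigenvalue_star_matrixI)
qed

text \<open>Two distinct elements of \<open>{-m, 0, m}\<close> differ by \<open>m\<close> or
  \<open>2 * m\<close>.\<close>

lemma min_eigenvalue_gap_star:
  assumes "finite V" "0 \<in> V" "card V = Suc (m ^ 2)" "0 < m"
  shows "real m \<le> min_eigenvalue_gap (star V)"
proof -
  let ?S = "graph_spectrum (star V)"
  let ?D = "{dist x y | x y. x \<in> ?S \<and> y \<in> ?S \<and> x \<noteq> y}"
  note spec = graph_spectrum_star[OF assms]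
  have "finite ?S"
    using spec(1) by (rule finite_subset) simp
  then have "finite ((\<lambda>(x, y). dist x y) ` (?S \<times> ?S))" by blast
  then have "finite ?D" by (rule rev_finite_subset) auto
  \<comment> \<open>\<open>Min\<close> is meaningful only on a finite nonempty set; the pair
    \<open>m\<close>, \<open>-m\<close> provides an element.\<close>
  moreover have "of_nat m \<noteq> (- of_nat m :: complex)"
    using assms(4) by (simp add: eq_neg_iff_add_eq_0 flip: of_nat_add)
  then have "dist (of_nat m :: complex) (- of_nat m) \<in> ?D"
    using spec(2) by blast
  then have "?D \<noteq> {}" by blast
  moreover have "real m \<le> d" if d: "d \<in> ?D" for d
  proof -
    obtain x y where "d = dist x y" "x \<in> ?S" "y \<in> ?S" "x \<noteq> y"
      using d by blast
    moreover from this have "x \<in> {- of_nat m, 0, of_nat m}" "y \<in> {- of_nat m, 0, of_nat m}"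
      using spec(1) by auto
    moreover have "norm (of_nat m + of_nat m :: complex) = 2 * real m"
      by (metis mult_2 norm_of_nat of_nat_add of_nat_mult of_nat_numeral)
    ultimately show ?thesis
      by (auto simp: dist_norm norm_minus_commute minus_diff_eq norm_minus_cancel)
  qed
  ultimately show ?thesis
    unfolding min_eigenvalue_gap_def by (subst Min_ge_iff) auto
qed

theorem theorem20:
  shows "\<exists>T :: nat \<Rightarrow> (nat, nat \<times> nat) pre_digraph.
    (\<forall>n\<ge>1. undirected_tree (T n) \<and> integral_graph (T n) \<and>
       (\<exists>i j. cospectral_vertices (T n) i j \<and> graph_dist (T n) i j = 2)) \<and>
    filterlim (\<lambda>n. min_eigenvalue_gap (T n)) at_top sequentially"
proof (intro exI conjI allI impI)
  \<comment> \<open>The center 0 and the leaves from 1 to \<open>Suc n ^ 2\<close>, so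
    \<open>m = Suc n\<close>. The shift by one gives at least two leaves already at
    \<open>n = 1\<close> and keeps \<open>m\<close> positive at \<open>n = 0\<close>, so that the
    gap bound holds for every \<open>n\<close>.\<close>
  let ?V = "\<lambda>n. {..Suc n ^ 2}"
  fix n :: nat
  assume "1 \<le> n"
  then have leaves: "1 \<in> ?V n" "2 \<in> ?V n"
    by (auto simp: power2_eq_square)
  show "undirected_tree (star (?V n))"
    by (simp add: undirected_tree_star)
  show "integral_graph (star (?V n))"
    unfolding integral_graph_def
    by (rule subset_trans[OF graph_spectrum_star(1)[where m = "Suc n"]]) auto
  show "cospectral_vertices (star (?V n)) 1 2"
    using leaves by (intro cospectral_star_leaves) auto
  show "graph_dist (star (?V n)) 1 2 = 2"
    using leaves by (intro graph_dist_star_leaves) auto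
next
  show "filterlim (\<lambda>n. min_eigenvalue_gap (star {..Suc n ^ 2})) at_top sequentially"
  proof (rule filterlim_at_top_mono)
    show "filterlim (\<lambda>n. real (Suc n)) at_top sequentially"
      using filterlim_real_sequentially filterlim_sequentially_Suc by blast
    show "\<forall>\<^sub>F n in sequentially. real (Suc n) \<le> min_eigenvalue_gap (star {..Suc n ^ 2})"
      by (intro always_eventually allI min_eigenvalue_gap_star) auto
  qed
qed

end
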